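(* For all $m\ge 3$, the Sperner systems $\mathcal{M}^m_1$ and $\mathcal{M}^m_2$ are strongly hypomorphic.
   Context: A set system over a finite set $A$ (the ground set) is a set of subsets of $A$, called blocks; it is a Sperner system if no block is included in another. Set systems $\mathcal A$ over $A$ and $\mathcal B$ over $B$ are isomorphic, $\mathcal A\equiv\mathcal B$, if there is a bijection $\sigma\colon A\to B$ with $\{\sigma(S):S\in\mathcal A\}=\mathcal B$. For a two-element subset $I$ of $A$, let $\theta_I$ be the equivalence relation on $A$ whose only nonsingleton class is $I$; for $S\subseteq A$ let $S_I=\{x/\theta_I:x\in S\}\subseteq A/\theta_I$; for a Sperner system $\mathcal A$ over $A$ let $\mathcal A_I=\{S_I:S\in\mathcal A\}$ and let $\mathcal A^*_I$ be the set of inclusion-minimal elements of $\mathcal A_I$, a Sperner system over $A/\theta_I$. Two Sperner systems $\mathcal A,\mathcal B$ over the same ground set $A$ are strongly hypomorphic if $\mathcal A^*_I\equiv\mathcal B^*_I$ for every two-element subset $I$ of $A$. Let $[m]=\{1,\dots,m\}$. For each $n\in[m]$ let $n'$ be a new element (a primed copy of $n$), and $S'=\{n':n\in S\}$ for $S\subseteq[m]$. Let $E_m=[m]\cup[m]'$, a set with $2m$ elements. Addition of elements of $[m]$ is modulo $m$ with result taken in $[m]$. For $J\subseteq[m]$ let $F^m_J=J\cup([m]\setminus J)'$. Put $\mathcal F^m_1=\{F^m_J: J\subseteq[m],\ |J|\text{ odd}\}$ and $\mathcal F^m_2=\{F^m_J: J\subseteq[m],\ |J|\text{ even}\}$. For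 $p\in[m]$ let $G^m_p=E_m\setminus\{p,p',(p+1)'\}$ and $\mathcal G^m=\{G^m_p:p\in[m]\}$. For $i\in\{1,2\}$, $\mathcal M^m_i=\mathcal F^m_i\cup\mathcal G^m$, a Sperner system over $E_m$. *)

theory Defs
  imports Main
begin

definition set_system :: "'a set \<Rightarrow> 'a set set \<Rightarrow> bool" where
  "set_system A \<A> \<longleftrightarrow> finite A \<and> (\<forall>S\<in>\<A>. S \<subseteq> A)"

definition sperner_system :: "'a set \<Rightarrow> 'a set set \<Rightarrow> bool" where
  "sperner_system A \<A> \<longleftrightarrow>
     set_system A \<A> \<and> (\<forall>S\<in>\<A>. \<forall>T\<in>\<A>. S \<subseteq> T \<longrightarrow> S = T)"

definition isomorphic_systems :: "'a set \<Rightarrow> 'a set set \<Rightarrow> 'b set \<Rightarrow> 'b set set \<Rightarrow> bool" where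
  "isomorphic_systems A \<A> B \<B> \<longleftrightarrow> (\<exists>\<sigma>. bij_betw \<sigma> A B \<and> {\<sigma> ` S |S. S \<in> \<A>} = \<B>)"

definition ident_rel :: "'a set \<Rightarrow> 'a set \<Rightarrow> ('a \<times> 'a) set" where
  "ident_rel A I = {(x, y). x \<in> A \<and> y \<in> A \<and> (x = y \<or> (x \<in> I \<and> y \<in> I))}"

text \<open>For a block S of a system over A, the library quotient of S by a relation on A is the set
  of the classes, formed in A, of the elements of S; a class need not be a subset of S.\<close>

definition ident_system :: "'a set \<Rightarrow> 'a set \<Rightarrow> 'a set set \<Rightarrow> 'a set set set" where
  "ident_system A I \<A> = {S // ident_rel A I |S. S \<in> \<A>}"

definition minimal_blocks :: "'a set set \<Rightarrow> 'a set set" where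
  "minimal_blocks \<A> = {S \<in> \<A>. \<forall>T\<in>\<A>. T \<subseteq> S \<longrightarrow> T = S}"

definition ident_minor :: "'a set \<Rightarrow> 'a set \<Rightarrow> 'a set set \<Rightarrow> 'a set set set" where
  "ident_minor A I \<A> = minimal_blocks (ident_system A I \<A>)"

definition strongly_hypomorphic :: "'a set \<Rightarrow> 'a set set \<Rightarrow> 'a set set \<Rightarrow> bool" where
  "strongly_hypomorphic A \<A> \<B> \<longleftrightarrow>
     sperner_system A \<A> \<and> sperner_system A \<B> \<and>
     (\<forall>I. I \<subseteq> A \<and> card I = 2 \<longrightarrow>
        isomorphic_systems (A // ident_rel A I) (ident_minor A I \<A>)
                           (A // ident_rel A I) (ident_minor A I \<B>))"

text \<open>An element n of {1..m} is encoded as Inl n, its primed copy as Inr n.\<close>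

definition E_set :: "nat \<Rightarrow> (nat + nat) set" where
  "E_set m = Inl ` {1..m} \<union> Inr ` {1..m}"

text \<open>The representative in {1..m} of the residue class of k modulo m.\<close>

definition cyc :: "nat \<Rightarrow> nat \<Rightarrow> nat" where
  "cyc m k = (if k mod m = 0 then m else k mod m)"

definition F_block :: "nat \<Rightarrow> nat set \<Rightarrow> (nat + nat) set" where
  "F_block m J = Inl ` J \<union> Inr ` ({1..m} - J)"

definition F1 :: "nat \<Rightarrow> (nat + nat) set set" where
  "F1 m = {F_block m J |J. J \<subseteq> {1..m} \<and> odd (card J)}"

definition F2 :: "nat \<Rightarrow> (nat + nat) set set" where
  "F2 m = {F_block m J |J. J \<subseteq> {1..m} \<and> even (card J)}"

definition G_block :: "nat \<Rightarrow> nat \<Rightarrow> (nat + nat) set" where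
  "G_block m p = E_set m - {Inl p, Inr p, Inr (cyc m (p + 1))}"

definition G_sys :: "nat \<Rightarrow> (nat + nat) set set" where
  "G_sys m = {G_block m p |p. p \<in> {1..m}}"

definition M1 :: "nat \<Rightarrow> (nat + nat) set set" where
  "M1 m = F1 m \<union> G_sys m"

definition M2 :: "nat \<Rightarrow> (nat + nat) set set" where
  "M2 m = F2 m \<union> G_sys m"

end

theory Submission
  imports Defs "HOL-Combinatorics.Transposition"
begin

text \<open>Exchanging n and n' flips the parity of J in F_J. If I = {n, n'}, this exchange is invisible
  after identification. Otherwise I lies over two distinct indices, and since m > 2 one of them,
  a, has a successor k = a + 1 over which I has no element. Exchanging k and k' fixes I, takes the
  first family of blocks F_J to the second and fixes every G_p with p distinct from a. The one
  remaining block G_a contains, after identification, blocks F_J of either parity, so it does not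
  affect the minimal blocks.\<close>

section \<open>Minimal blocks and isomorphisms under identification of points\<close>

lemma equiv_ident_rel: "equiv A (ident_rel A I)"
  unfolding ident_rel_def by (intro equivI refl_onI symI transI) auto

text \<open>An element of S missing from T does no harm if it lies in I and T meets I, because any
  element of T in I represents the same class. Inclusions between identified blocks are all proved
  this way.\<close>

lemma quotient_ident_rel_mono:
  assumes "S \<subseteq> A" "T \<subseteq> A" "\<And>x. x \<in> S \<Longrightarrow> x \<notin> T \<Longrightarrow> x \<in> I \<and> T \<inter> I \<noteq> {}"
  shows "S // ident_rel A I \<subseteq> T // ident_rel A I"
proof
  fix c assume "c \<in> S // ident_rel A I"
  then obtain x where x: "x \<in> S" and c: "c = ident_rel A I `` {x}"
    by (auto elim: quotientE)
  from assms x have "\<exists>y\<in>T. (x, y) \<in> ident_rel A I"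
    unfolding ident_rel_def by (cases "x \<in> T") blast+
  then obtain y where "y \<in> T" "(x, y) \<in> ident_rel A I" ..
  then show "c \<in> T // ident_rel A I"
    using c equiv_class_eq[OF equiv_ident_rel] by (metis quotientI)
qed

text \<open>A minimal member of the union that comes from \<H> contains some member of \<S> and so
  equals it. Conversely, a member of \<H> below a minimal S of \<S> is squeezed between S and a
  member of \<S>, which must be S itself.\<close>

lemma minimal_blocks_Un_superfluous:
  assumes "\<And>H. H \<in> \<H> \<Longrightarrow> \<exists>S\<in>\<S>. S \<subseteq> H"
  shows "minimal_blocks (\<S> \<union> \<H>) = minimal_blocks \<S>"
proof
  show "minimal_blocks (\<S> \<union> \<H>) \<subseteq> minimal_blocks \<S>"
  proof
    fix S assume S: "S \<in> minimal_blocks (\<S> \<union> \<H>)"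
    then have least: "T = S" if "T \<in> \<S>" "T \<subseteq> S" for T
      using that by (simp add: minimal_blocks_def)
    have "S \<in> \<S>"
    proof (cases "S \<in> \<H>")
      case True
      then obtain T where "T \<in> \<S>" "T \<subseteq> S"
        using assms by metis
      then show ?thesis
        using least by metis
    next
      case False
      then show ?thesis
        using S by (simp add: minimal_blocks_def)
    qed
    then show "S \<in> minimal_blocks \<S>"
      using least by (simp add: minimal_blocks_def)
  qed
  show "minimal_blocks \<S> \<subseteq> minimal_blocks (\<S> \<union> \<H>)"
  proof
    fix S assume S: "S \<in> minimal_blocks \<S>"
    have "H = S" if H: "H \<in> \<H>" "H \<subseteq> S" for H
    proof -
      obtain T where "T \<in> \<S>" "T \<subseteq> H"
        using assms H(1) by metis
      moreover from this have "T = S"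
        using S H(2) by (simp add: minimal_blocks_def)
      ultimately show ?thesis
        using H(2) by simp
    qed
    then show "S \<in> minimal_blocks (\<S> \<union> \<H>)"
      using S by (auto simp: minimal_blocks_def)
  qed
qed

text \<open>Injectivity on all points of the blocks makes \<open>image f\<close> preserve and
  reflect inclusion, hence also minimality.\<close>

lemma minimal_blocks_image:
  assumes "inj_on f (\<Union>\<S>)"
  shows "minimal_blocks (image f ` \<S>) = image f ` minimal_blocks \<S>"
proof -
  have sub: "f ` T \<subseteq> f ` S \<longleftrightarrow> T \<subseteq> S" if "S \<in> \<S>" "T \<in> \<S>" for S T
  proof
    assume fT: "f ` T \<subseteq> f ` S"
    show "T \<subseteq> S"
    proof
      fix x assume x: "x \<in> T"
      then obtain y where "y \<in> S" "f x = f y"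
        using fT by blast
      moreover have "x \<in> \<Union>\<S>" "y \<in> \<Union>\<S>"
        using that x \<open>y \<in> S\<close> by blast+
      ultimately show "x \<in> S"
        using inj_onD[OF assms] by metis
    qed
  qed (rule image_mono)
  then have eq: "f ` T = f ` S \<longleftrightarrow> T = S" if "S \<in> \<S>" "T \<in> \<S>" for S T
    using that by (metis subset_antisym order_refl)
  have key: "f ` S \<in> minimal_blocks (image f ` \<S>) \<longleftrightarrow> S \<in> minimal_blocks \<S>" if "S \<in> \<S>" for S
    using that by (simp add: minimal_blocks_def sub eq)
  show ?thesis
  proof (intro equalityI subsetI)
    fix Y assume Y: "Y \<in> minimal_blocks (image f ` \<S>)"
    then obtain S where "S \<in> \<S>" "Y = f ` S"
      by (auto simp: minimal_blocks_def)
    then show "Y \<in> image f ` minimal_blocks \<S>"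
      using Y key by simp
  next
    fix Y assume "Y \<in> image f ` minimal_blocks \<S>"
    then obtain S where "S \<in> minimal_blocks \<S>" "Y = f ` S" ..
    then show "Y \<in> minimal_blocks (image f ` \<S>)"
      using key by (simp add: minimal_blocks_def)
  qed
qed

text \<open>A permutation of A that maps I onto itself sends classes to classes, so
  \<open>image \<tau>\<close> acts on the quotient; this action is the isomorphism.\<close>

lemma isomorphic_ident_minor_image:
  assumes bij: "bij_betw \<tau> A A" and I: "I \<subseteq> A" "\<tau> ` I = I" and \<A>: "\<And>S. S \<in> \<A> \<Longrightarrow> S \<subseteq> A"
  shows "isomorphic_systems (A // ident_rel A I) (ident_minor A I \<A>)
           (A // ident_rel A I) (ident_minor A I (image \<tau> ` \<A>))"
proof -
  let ?r = "ident_rel A I"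
  have img: "\<tau> ` A = A" and inj: "inj_on \<tau> A"
    using bij by (auto simp: bij_betw_def)
  have inI: "\<tau> x \<in> I \<longleftrightarrow> x \<in> I" if "x \<in> A" for x
    using inj_on_image_mem_iff[OF inj that I(1)] I(2) by simp
  have cls: "\<tau> ` (?r `` {x}) = ?r `` {\<tau> x}" if "x \<in> A" for x
  proof -
    \<comment> \<open>With the classes explicit, only two facts matter: \<tau> fixes I as a set and
      preserves membership in I.\<close>
    have "?r `` {y} = (if y \<in> I then I else {y})" if "y \<in> A" for y
      using that I(1) by (auto simp: ident_rel_def)
    moreover have "\<tau> x \<in> A"
      using that img by blast
    ultimately show ?thesis
      using that inI[OF that] I(2) by simp
  qed
  have quot: "image \<tau> ` (S // ?r) = \<tau> ` S // ?r" if "S \<subseteq> A" for S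
    using that cls by (auto simp: quotient_def image_UN subset_iff)
  have inj_classes: "inj_on (image \<tau>) (A // ?r)"
  proof (rule inj_onI)
    fix c d assume "c \<in> A // ?r" "d \<in> A // ?r" "\<tau> ` c = \<tau> ` d"
    moreover have "c \<subseteq> A" "d \<subseteq> A"
      using calculation by (auto simp: quotient_def ident_rel_def)
    ultimately show "c = d"
      using inj by (simp add: inj_on_image_eq_iff)
  qed
  have "bij_betw (image \<tau>) (A // ?r) (A // ?r)"
    using inj_classes quot[of A] img by (simp add: bij_betw_def)
  moreover have "image (image \<tau>) ` ident_minor A I \<A> = ident_minor A I (image \<tau> ` \<A>)"
  proof -
    \<comment> \<open>The points of the identified blocks are classes of A, so injectivity on the
      quotient suffices for \<open>minimal_blocks_image\<close>.\<close>
    have "\<Union>(ident_system A I \<A>) \<subseteq> A // ?r"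
      using \<A> by (fastforce simp: ident_system_def quotient_def)
    then have "inj_on (image \<tau>) (\<Union>(ident_system A I \<A>))"
      using inj_classes inj_on_subset by blast
    moreover have "ident_system A I (image \<tau> ` \<A>) = image (image \<tau>) ` ident_system A I \<A>"
      unfolding ident_system_def setcompr_eq_image Collect_mem_eq image_image
      using quot \<A> by (intro image_cong[OF refl]) simp
    ultimately show ?thesis
      by (simp add: ident_minor_def minimal_blocks_image)
  qed
  ultimately show ?thesis
    unfolding isomorphic_systems_def setcompr_eq_image Collect_mem_eq by (intro exI conjI)
qed

section \<open>Symmetric difference with a single index, and parity\<close>

definition toggle :: "'a \<Rightarrow> 'a set \<Rightarrow> 'a set" where
  "toggle n J = (if n \<in> J then J - {n} else insert n J)"

lemma toggle_subset: "n \<in> A \<Longrightarrow> J \<subseteq> A \<Longrightarrow> toggle n J \<subseteq> A"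
  by (auto simp: toggle_def)

lemma toggle_toggle [simp]: "toggle n (toggle n J) = J"
  by (auto simp: toggle_def)

lemma mem_toggle: "x \<in> toggle n J \<longleftrightarrow> (if x = n then x \<notin> J else x \<in> J)"
  by (auto simp: toggle_def)

lemma even_card_toggle: "finite J \<Longrightarrow> even (card (toggle n J)) \<longleftrightarrow> odd (card J)"
proof (cases "n \<in> J")
  case True
  assume "finite J"
  with True have "card J = Suc (card (toggle n J))"
    by (simp only: toggle_def if_True card_Suc_Diff1)
  then show ?thesis by simp
qed (simp add: toggle_def)

lemma toggle_even_iff_odd:
  assumes "J \<subseteq> {1..m::nat}"
  shows "even (card (toggle n J)) \<longleftrightarrow> odd (card J)"
  using finite_subset[OF assms] by (simp add: even_card_toggle)

section \<open>Blocks, the cyclic successor and the Sperner property\<close>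

lemma mem_F_block [simp]:
  "Inl x \<in> F_block m J \<longleftrightarrow> x \<in> J"
  "Inr x \<in> F_block m J \<longleftrightarrow> x \<in> {1..m} \<and> x \<notin> J"
  by (auto simp: F_block_def)

lemma mem_E_set [simp]: "Inl x \<in> E_set m \<longleftrightarrow> x \<in> {1..m}" "Inr x \<in> E_set m \<longleftrightarrow> x \<in> {1..m}"
  by (auto simp: E_set_def)

lemma F_block_subset: "J \<subseteq> {1..m} \<Longrightarrow> F_block m J \<subseteq> E_set m"
  by (auto simp: F_block_def E_set_def)

lemma G_block_subset: "G_block m p \<subseteq> E_set m"
  by (auto simp: G_block_def)

lemma cyc_Suc: "p \<in> {1..m} \<Longrightarrow> cyc m (Suc p) = (if p = m then 1 else p + 1)"
proof (cases "p = m")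
  case True
  \<comment> \<open>For m = 1 the remainder of m + 1 is 0 instead of 1, but \<open>cyc\<close> then
    returns m, which is again 1.\<close>
  then show ?thesis
    by (cases "m = 1") (simp_all add: cyc_def mod_Suc)
next
  case False
  assume "p \<in> {1..m}"
  with False have "p mod m = p" "p < m"
    by simp_all
  then show ?thesis
    by (simp add: cyc_def mod_Suc)
qed

lemma cyc_Suc_inj:
  assumes "p \<in> {1..m}" "q \<in> {1..m}" "cyc m (p + 1) = cyc m (q + 1)"
  shows "p = q"
proof -
  have "(if p = m then 1 else Suc p) = (if q = m then 1 else Suc q)"
    using assms(3) unfolding Suc_eq_plus1[symmetric] cyc_Suc[OF assms(1)] cyc_Suc[OF assms(2)] .
  then show ?thesis
    using assms(1,2) by (cases "p = m"; cases "q = m") simp_all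
qed

text \<open>The unprimed elements give J \<subseteq> K; the primed ones record the complements and
  give the reverse inclusion.\<close>

lemma F_block_subset_F_block:
  assumes "J \<subseteq> {1..m}" "K \<subseteq> {1..m}" "F_block m J \<subseteq> F_block m K"
  shows "J = K"
proof (intro equalityI subsetI)
  fix x assume "x \<in> J"
  then have "Inl x \<in> F_block m K"
    by (intro subsetD[OF assms(3)]) simp
  then show "x \<in> K"
    by simp
next
  fix x assume x: "x \<in> K"
  show "x \<in> J"
  proof (rule ccontr)
    assume "x \<notin> J"
    then have "Inr x \<in> F_block m K"
      using assms(2) x by (intro subsetD[OF assms(3)]) auto
    then show False
      using x by simp
  qed
qed

text \<open>Each F_J meets every pair {n, n'} in exactly one element, whereas G_p misses the pair of
  p and contains some other pair completely, so neither includes the other. Distinct G_p are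
  incomparable because p is the only unprimed element that G_p lacks. A general \<F> serves both
  parities.\<close>

lemma sperner_F_G:
  assumes "m \<ge> 3" and \<F>: "\<And>S. S \<in> \<F> \<Longrightarrow> \<exists>J\<subseteq>{1..m}. S = F_block m J"
  shows "sperner_system (E_set m) (\<F> \<union> G_sys m)"
proof -
  have FG: "\<not> F_block m J \<subseteq> G_block m p" if "p \<in> {1..m}" for J p
  proof -
    have "Inl p \<in> F_block m J \<or> Inr p \<in> F_block m J"
      using that by auto
    then show ?thesis
      unfolding G_block_def by blast
  qed
  have GF: "\<not> G_block m p \<subseteq> F_block m J" if "p \<in> {1..m}" for J p
  proof -
    \<comment> \<open>As m is at least 3, some index q differs from p and its successor; G_p then
      contains both q and q'.\<close>
    have "card {p, cyc m (p + 1)} < card {1..m}"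
      using assms(1) card_insert_le_m1[of 2 "{cyc m (p + 1)}" p] by simp
    then obtain q where "q \<in> {1..m}" "q \<noteq> p" "q \<noteq> cyc m (p + 1)"
      by (metis card_mono finite.emptyI finite_insert insert_iff leD subsetI)
    then have "Inl q \<in> G_block m p" "Inr q \<in> G_block m p"
      by (auto simp: G_block_def)
    then show ?thesis
      using mem_F_block[of q m J] by blast
  qed
  have GG: "p = q" if "p \<in> {1..m}" "q \<in> {1..m}" "G_block m p \<subseteq> G_block m q" for p q
  proof (rule ccontr)
    assume "p \<noteq> q"
    then have "Inl q \<in> G_block m p"
      using that by (simp add: G_block_def)
    then have "Inl q \<in> G_block m q"
      using that(3) by (rule subsetD[rotated])
    then show False
      by (simp add: G_block_def)
  qed
  have "S \<subseteq> E_set m" if "S \<in> \<F> \<union> G_sys m" for S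
  proof (cases "S \<in> \<F>")
    case True
    then obtain J where "J \<subseteq> {1..m}" "S = F_block m J"
      using \<F> by metis
    then show ?thesis
      by (simp add: F_block_subset)
  next
    case False
    then show ?thesis
      using that by (auto simp: G_sys_def G_block_def)
  qed
  moreover have "finite (E_set m)"
    by (simp add: E_set_def)
  moreover have "S = T" if S: "S \<in> \<F> \<union> G_sys m" and T: "T \<in> \<F> \<union> G_sys m" and "S \<subseteq> T" for S T
  proof -
    have "(\<exists>J\<subseteq>{1..m}. S = F_block m J) \<or> (\<exists>p\<in>{1..m}. S = G_block m p)"
      using S \<F> by (auto simp: G_sys_def)
    moreover have "(\<exists>J\<subseteq>{1..m}. T = F_block m J) \<or> (\<exists>p\<in>{1..m}. T = G_block m p)"
      using T \<F> by (auto simp: G_sys_def)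
    ultimately show ?thesis
    proof (elim disjE exE bexE conjE)
      fix J K assume "J \<subseteq> {1..m}" "S = F_block m J" "K \<subseteq> {1..m}" "T = F_block m K"
      then show ?thesis
        using \<open>S \<subseteq> T\<close> F_block_subset_F_block[of J m K] by simp
    next
      fix J p assume "S = F_block m J" "p \<in> {1..m}" "T = G_block m p"
      then show ?thesis
        using \<open>S \<subseteq> T\<close> FG[of p J] by simp
    next
      fix p J assume "p \<in> {1..m}" "S = G_block m p" "T = F_block m J"
      then show ?thesis
        using \<open>S \<subseteq> T\<close> GF[of p J] by simp
    next
      fix p q assume "p \<in> {1..m}" "S = G_block m p" "q \<in> {1..m}" "T = G_block m q"
      then show ?thesis
        using \<open>S \<subseteq> T\<close> GG[of p q] by simp
    qed
  qed
  ultimately show ?thesis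
    unfolding sperner_system_def set_system_def by blast
qed

section \<open>The exchange of k and k' on blocks\<close>

lemma transpose_F_block:
  assumes "k \<in> {1..m}"
  shows "transpose (Inl k) (Inr k) ` F_block m J = F_block m (toggle k J)"
proof (rule set_eqI)
  fix x
  show "x \<in> transpose (Inl k) (Inr k) ` F_block m J \<longleftrightarrow> x \<in> F_block m (toggle k J)"
    using assms by (cases x) (auto simp: in_transpose_image_iff transpose_def mem_toggle)
qed

text \<open>Since k is not the successor of p, the elements k and k' are both missing from G_p (if k
  = p) or both present.\<close>

lemma transpose_G_block:
  assumes "k \<in> {1..m}" "cyc m (p + 1) \<noteq> k"
  shows "transpose (Inl k) (Inr k) ` G_block m p = G_block m p"
proof (rule set_eqI)
  fix x
  show "x \<in> transpose (Inl k) (Inr k) ` G_block m p \<longleftrightarrow> x \<in> G_block m p"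
    using assms by (cases x) (auto simp: in_transpose_image_iff transpose_def G_block_def)
qed

text \<open>Toggling k changes the parity of J and is its own inverse, so it maps the odd index sets
  onto the even ones.\<close>

lemma transpose_F1:
  assumes "k \<in> {1..m}"
  shows "image (transpose (Inl k) (Inr k)) ` F1 m = F2 m"
proof
  show "image (transpose (Inl k) (Inr k)) ` F1 m \<subseteq> F2 m"
  proof
    fix S assume "S \<in> image (transpose (Inl k) (Inr k)) ` F1 m"
    then obtain J where J: "J \<subseteq> {1..m}" "odd (card J)" "S = F_block m (toggle k J)"
      by (auto simp: F1_def transpose_F_block[OF assms])
    then show "S \<in> F2 m"
      using toggle_subset[OF assms J(1)] toggle_even_iff_odd[OF J(1), of k]
      unfolding F2_def by blast
  qed
  show "F2 m \<subseteq> image (transpose (Inl k) (Inr k)) ` F1 m"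
  proof
    fix S assume "S \<in> F2 m"
    then obtain J where J: "J \<subseteq> {1..m}" "even (card J)" "S = F_block m J"
      by (auto simp: F2_def)
    then have "F_block m (toggle k J) \<in> F1 m"
      using toggle_subset[OF assms J(1)] toggle_even_iff_odd[OF J(1), of k]
      unfolding F1_def by blast
    moreover have "S = transpose (Inl k) (Inr k) ` F_block m (toggle k J)"
      using assms J by (simp add: transpose_F_block)
    ultimately show "S \<in> image (transpose (Inl k) (Inr k)) ` F1 m"
      by blast
  qed
qed

section \<open>The two kinds of identified pairs\<close>

lemma ident_system_Un: "ident_system A I (\<A> \<union> \<B>) = ident_system A I \<A> \<union> ident_system A I \<B>"
  by (auto simp: ident_system_def)

text \<open>F_J and its toggled version differ only inside I, and both meet I, so they have the same
  classes.\<close>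

lemma ident_system_F1_twins:
  assumes "n \<in> {1..m}" "I = {Inl n, Inr n}"
  shows "ident_system (E_set m) I (F1 m) = ident_system (E_set m) I (F2 m)"
proof -
  have sub: "F_block m J // ident_rel (E_set m) I \<subseteq> F_block m (toggle n J) // ident_rel (E_set m) I"
    if "J \<subseteq> {1..m}" for J
  proof (rule quotient_ident_rel_mono)
    show "F_block m J \<subseteq> E_set m" "F_block m (toggle n J) \<subseteq> E_set m"
      using that assms(1) by (simp_all add: F_block_subset toggle_subset)
    show "x \<in> I \<and> F_block m (toggle n J) \<inter> I \<noteq> {}"
      if "x \<in> F_block m J" "x \<notin> F_block m (toggle n J)" for x
      using that assms by (cases x) (auto simp: mem_toggle split: if_splits)
  qed
  have eq: "F_block m (toggle n J) // ident_rel (E_set m) I = F_block m J // ident_rel (E_set m) I"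
    if "J \<subseteq> {1..m}" for J
    \<comment> \<open>The reverse inclusion is \<open>sub\<close> for the toggled set, since
      toggling twice restores J.\<close>
    using sub[OF that] sub[OF toggle_subset[OF assms(1) that]] by simp
  have "transpose (Inl n) (Inr n) ` S // ident_rel (E_set m) I = S // ident_rel (E_set m) I"
    if "S \<in> F1 m" for S
    using that eq by (auto simp: F1_def transpose_F_block[OF assms(1)])
  then show ?thesis
    \<comment> \<open>Writing \<open>F2 m\<close> as the image of \<open>F1 m\<close> under the
      exchange pairs up blocks with equal quotients.\<close>
    unfolding transpose_F1[OF assms(1), symmetric] ident_system_def setcompr_eq_image Collect_mem_eq image_image
    by (intro image_cong[OF refl]) simp
qed

text \<open>G_a lacks exactly a, a' and k'. If J contains k, and contains a exactly when u is
  unprimed, then u is the only element of F_J outside G_a; it is identified with v, which lies in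
  G_a because b is neither a nor k. The parameter \<open>P\<close> prescribes the parity of
  J.\<close>

lemma superfluous_G_block:
  assumes ab: "a \<in> {1..m}" "b \<in> {1..m}" "a \<noteq> b" and k: "k = cyc m (a + 1)" "k \<in> {1..m}" "k \<noteq> a" "k \<noteq> b"
    and u: "u = Inl a \<or> u = Inr a" and v: "v = Inl b \<or> v = Inr b"
  shows "\<exists>J\<subseteq>{1..m}. (even (card J) \<longleftrightarrow> P) \<and>
    F_block m J // ident_rel (E_set m) {u, v} \<subseteq> G_block m a // ident_rel (E_set m) {u, v}"
proof -
  define J0 where "J0 = {k} \<union> (if u = Inl a then {a} else {})"
  \<comment> \<open>Toggling b corrects the parity without affecting the membership of a and
    k.\<close>
  define J where "J = (if even (card J0) = P then J0 else toggle b J0)"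
  have "J0 \<subseteq> {1..m}"
    using ab k by (auto simp: J0_def)
  then have J: "J \<subseteq> {1..m}" "even (card J) \<longleftrightarrow> P"
    using toggle_subset[OF ab(2)] toggle_even_iff_odd by (auto simp: J_def)
  have mem: "k \<in> J" "a \<in> J \<longleftrightarrow> u = Inl a"
    using ab k by (auto simp: J_def J0_def mem_toggle)
  have "F_block m J // ident_rel (E_set m) {u, v} \<subseteq> G_block m a // ident_rel (E_set m) {u, v}"
  proof (rule quotient_ident_rel_mono)
    fix x assume x: "x \<in> F_block m J" "x \<notin> G_block m a"
    then have "x \<in> {Inl a, Inr a, Inr k}"
      using F_block_subset[OF J(1)] k(1) by (auto simp: G_block_def)
    then have "x = u"
      using x mem u by auto
    moreover have "v \<in> G_block m a"
      using v ab k by (auto simp: G_block_def)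
    ultimately show "x \<in> {u, v} \<and> G_block m a \<inter> {u, v} \<noteq> {}"
      by blast
  qed (rule F_block_subset[OF J(1)] G_block_subset)+
  then show ?thesis
    using J by blast
qed

lemma isomorphic_minors_distinct_indices:
  assumes ab: "a \<in> {1..m}" "b \<in> {1..m}" "a \<noteq> b" and k: "k = cyc m (a + 1)" "k \<in> {1..m}" "k \<noteq> a" "k \<noteq> b"
    and u: "u = Inl a \<or> u = Inr a" and v: "v = Inl b \<or> v = Inr b" and I: "I = {u, v}"
  shows "isomorphic_systems (E_set m // ident_rel (E_set m) I) (ident_minor (E_set m) I (M1 m))
           (E_set m // ident_rel (E_set m) I) (ident_minor (E_set m) I (M2 m))"
proof -
  let ?\<tau> = "transpose (Inl k) (Inr k)"
  \<comment> \<open>G_a must be set aside because the exchange moves it: it contains k but not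
    k'.\<close>
  define \<G> where "\<G> = G_block m ` ({1..m} - {a})"
  have G_sys: "G_sys m = \<G> \<union> {G_block m a}"
    using ab(1) by (auto simp: G_sys_def \<G>_def)
  have drop: "ident_minor (E_set m) I (\<F> \<union> G_sys m) = ident_minor (E_set m) I (\<F> \<union> \<G>)"
    if ex: "\<exists>J. F_block m J \<in> \<F> \<and>
      F_block m J // ident_rel (E_set m) I \<subseteq> G_block m a // ident_rel (E_set m) I" for \<F>
  proof -
    have "\<exists>S \<in> ident_system (E_set m) I (\<F> \<union> \<G>). S \<subseteq> H"
      if "H \<in> ident_system (E_set m) I {G_block m a}" for H
      using that ex unfolding ident_system_def by blast
    then show ?thesis
      unfolding ident_minor_def G_sys Un_assoc[symmetric] ident_system_Un[of _ _ "\<F> \<union> \<G>"]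
      by (intro minimal_blocks_Un_superfluous)
  qed
  \<comment> \<open>The choice \<open>False\<close> yields an odd index set, as \<open>F1\<close>
    requires; \<open>True\<close> below yields an even one for \<open>F2\<close>.\<close>
  have M1: "ident_minor (E_set m) I (M1 m) = ident_minor (E_set m) I (F1 m \<union> \<G>)"
    unfolding M1_def using superfluous_G_block[OF ab k u v, of False] I
    by (intro drop) (auto simp: F1_def)
  have M2: "ident_minor (E_set m) I (M2 m) = ident_minor (E_set m) I (F2 m \<union> \<G>)"
    unfolding M2_def using superfluous_G_block[OF ab k u v, of True] I
    by (intro drop) (auto simp: F2_def)
  have "image ?\<tau> ` \<G> = \<G>"
  proof -
    \<comment> \<open>Taking successors is injective, so k, the successor of a, is not the successor
      of any other p.\<close>
    have "?\<tau> ` G_block m p = G_block m p" if "p \<in> {1..m} - {a}" for p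
      using that ab k cyc_Suc_inj by (intro transpose_G_block) blast+
    then show ?thesis
      unfolding \<G>_def image_image by (intro image_cong) auto
  qed
  then have img: "image ?\<tau> ` (F1 m \<union> \<G>) = F2 m \<union> \<G>"
    by (simp add: image_Un transpose_F1[OF k(2)])
  have "bij_betw ?\<tau> (E_set m) (E_set m)"
    using k(2) by (simp add: bij_betw_def transpose_image_eq)
  moreover have "I \<subseteq> E_set m"
    using ab u v I by auto
  moreover have "?\<tau> u = u" "?\<tau> v = v"
    using k(3,4) u v by (auto intro: transpose_apply_other)
  then have "?\<tau> ` I = I"
    by (simp add: I)
  moreover have "S \<subseteq> E_set m" if "S \<in> F1 m \<union> \<G>" for S
    using that F_block_subset G_block_subset by (auto simp: F1_def \<G>_def subset_iff)
  ultimately show ?thesis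
    unfolding M1 M2 img[symmetric] by (rule isomorphic_ident_minor_image)
qed

section \<open>Strong hypomorphism, by the position of the two identified points\<close>

theorem proposition3p14:
  fixes m :: nat
  assumes "m \<ge> 3"
  shows "strongly_hypomorphic (E_set m) (M1 m) (M2 m)"
proof -
  have "isomorphic_systems (E_set m // ident_rel (E_set m) I) (ident_minor (E_set m) I (M1 m))
           (E_set m // ident_rel (E_set m) I) (ident_minor (E_set m) I (M2 m))"
    if I: "I \<subseteq> E_set m" "card I = 2" for I
  proof -
    obtain u v where uv: "I = {u, v}" "u \<noteq> v"
      using I(2) by (auto simp: card_2_iff)
    obtain a where a: "a \<in> {1..m}" "u = Inl a \<or> u = Inr a"
      using I(1) uv by (auto simp: E_set_def)
    obtain b where b: "b \<in> {1..m}" "v = Inl b \<or> v = Inr b"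
      using I(1) uv by (auto simp: E_set_def)
    show ?thesis
    proof (cases "a = b")
      case True
      then have "I = {Inl a, Inr a}"
        using uv a b by auto
      then have "ident_minor (E_set m) I (M1 m) = ident_minor (E_set m) I (M2 m)"
        using ident_system_F1_twins[OF a(1)]
        by (simp add: ident_minor_def M1_def M2_def ident_system_Un)
      then show ?thesis
        \<comment> \<open>The two minors coincide here, so the identity is an isomorphism.\<close>
        unfolding isomorphic_systems_def by (intro exI[of _ id]) simp
    next
      case False
      have next_index: "cyc m (p + 1) \<in> {1..m}" "cyc m (p + 1) \<noteq> p" if "p \<in> {1..m}" for p
        using that assms by (auto simp: cyc_Suc)
      show ?thesis
      proof (cases "cyc m (a + 1) = b")
        case False
        then show ?thesis
          using isomorphic_minors_distinct_indices[OF a(1) b(1) \<open>a \<noteq> b\<close> refl _ _ _ a(2) b(2) uv(1)]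
            next_index[OF a(1)] by blast
      next
        case True
        \<comment> \<open>If b succeeds a, then a does not succeed b, as a + 2 and a differ modulo m
          for m at least 3. The preceding lemma therefore applies with the roles of a and b
          exchanged.\<close>
        then have "cyc m (b + 1) \<noteq> a"
          using a b assms by (auto simp: cyc_Suc split: if_splits)
        moreover have "I = {v, u}"
          using uv(1) by blast
        ultimately show ?thesis
          using isomorphic_minors_distinct_indices[OF b(1) a(1) \<open>a \<noteq> b\<close>[symmetric] refl _ _ _ b(2) a(2)]
            next_index[OF b(1)] by blast
      qed
    qed
  qed
  moreover have "sperner_system (E_set m) (M1 m)" "sperner_system (E_set m) (M2 m)"
    unfolding M1_def M2_def F1_def F2_def by (rule sperner_F_G[OF assms], blast)+
  ultimately show ?thesis
    unfolding strongly_hypomorphic_def by blast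
qed

end
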